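(* Let $q$ be a prime power and let $k>1$ and $n$ be positive integers with $\gcd(k,n+1)=1$ and $\gcd(k,n)\neq 1$. Let $d=\gcd\left(\frac{q^{kn}-1}{q^k-1},\frac{q^n-1}{q-1}\right)$, $v=\frac{q^{k(n+1)}-1}{q^k-1}$ and $m=q\frac{q^n-1}{q-1}$. Then there exists a simple and indecomposable $m$-factorization of $\lambda K_v$, where $\lambda=t\,\frac{q^n-1}{d(q-1)}$ for some $t$ in $$\left\{1,\dots,d\,\frac{q^{\binom{n+1}{2}k}(q^k-1)}{q^{k-1}(n+1)}\prod_{i=1}^{n-1}(q^{ki}-1)\right\}.$$
   Context: The complete multigraph $\lambda K_v$ has $v$ vertices and exactly $\lambda$ edges joining each pair of distinct vertices. An $m$-factor of $\lambda K_v$ is a set of pairwise vertex-disjoint $m$-regular subgraphs which induce a partition of the vertices (i.e. a spanning $m$-regular subgraph). An $m$-factorization of $\lambda K_v$ is a collection of pairwise edge-disjoint $m$-factors which partition the edges; equivalently, when the factors are simple graphs, a family (multiset) of $m$-regular spanning graphs on the $v$ vertices such that each pair of distinct vertices is joined in exactly $\lambda$ of them. It is simple if its $m$-factors are pairwise distinct (as graphs on the vertex set). It is decomposable if there exist positive integers $\mu_1,\mu_2$ with $\mu_1+\mu_2=\lambda$ such that it is the union of an $m$-factorization of $\mu_1K_v$ and an $m$-factorization of $\mu_2K_v$; otherwise it is indecomposable. *)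

theory Defs
  imports Complex_Main "HOL-Library.Multiset" "HOL-Number_Theory.Prime_Powers"
begin

text \<open>
  A loopless multigraph on a finite vertex set is the multiset of its edges, each edge
  being the set of its two endpoints; the multiplicity of an edge is its number of parallel copies.
\<close>

type_synonym 'a mgraph = "'a set multiset"

definition complete_mgraph :: "nat \<Rightarrow> 'a set \<Rightarrow> 'a mgraph" where
  "complete_mgraph l V = repeat_mset l (mset_set {e. e \<subseteq> V \<and> card e = 2})"

definition mdegree :: "'a mgraph \<Rightarrow> 'a \<Rightarrow> nat" where
  "mdegree G x = size {#e \<in># G. x \<in> e#}"

definition is_factor :: "nat \<Rightarrow> nat \<Rightarrow> 'a set \<Rightarrow> 'a mgraph \<Rightarrow> bool" where
  "is_factor m l V G \<longleftrightarrow> G \<subseteq># complete_mgraph l V \<and> (\<forall>x\<in>V. mdegree G x = m)"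

text \<open>
  A factorization is a multiset of factors, since edge-disjoint factors may coincide as graphs
  on the vertex set. That the factors are pairwise edge-disjoint and partition the edges
  (parallel edges being distinct edges) is the equation of edge multisets.
\<close>

definition factorization :: "nat \<Rightarrow> nat \<Rightarrow> 'a set \<Rightarrow> 'a mgraph multiset \<Rightarrow> bool" where
  "factorization m l V F \<longleftrightarrow>
     (\<forall>G\<in>#F. is_factor m l V G) \<and> \<Sum>\<^sub># F = complete_mgraph l V"

definition simple_factorization :: "'a mgraph multiset \<Rightarrow> bool" where
  "simple_factorization F \<longleftrightarrow> (\<forall>G\<in>#F. count F G = 1)"

definition decomposable :: "nat \<Rightarrow> nat \<Rightarrow> 'a set \<Rightarrow> 'a mgraph multiset \<Rightarrow> bool" where
  "decomposable m l V F \<longleftrightarrow>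
     (\<exists>l1 l2 F1 F2. l1 > 0 \<and> l2 > 0 \<and> l1 + l2 = l \<and>
        factorization m l1 V F1 \<and> factorization m l2 V F2 \<and> F = F1 + F2)"

end

theory Submission
  imports Defs "HOL-Number_Theory.Cong"
begin

text \<open>
  The conditions on a factorization speak only of degrees, so a suitable one can be read off from
  a regular edge colouring of the complete graph. Put
  \<open>A = (q ^ n - 1) / (q - 1)\<close>, \<open>Q = q ^ k\<close> and \<open>B = (Q ^ n - 1) / (Q - 1)\<close>, so that \<open>m = q * A\<close> and
  \<open>v - 1 = Q * B\<close>; in particular \<open>m < v - 1\<close>.

  Colour the edges of \<open>K\<^sub>v\<close> so that every colour class is a 2-factor (for odd \<open>v\<close>, by cyclic
  differences) or a 1-factor (for even \<open>v\<close>, by the round-robin scheme). Place the colours on a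
  cycle and take as factors the unions of \<open>w\<close> consecutive classes, where \<open>w\<close> is \<open>m / 2\<close> or \<open>m\<close>;
  in the first case \<open>m\<close> has to be even, and it is, because \<open>q\<close> or the number \<open>n\<close> of summands of
  \<open>A\<close> is even when \<open>v\<close> is odd. Every edge lies in \<open>w\<close> of these factors, and they
  are distinct because a window is shorter than the cycle. So \<open>w K\<^sub>v\<close> has a simple
  \<open>m\<close>-factorization with \<open>w \<le> m\<close> (\<open>exists_simple_factorization\<close>).

  Splitting this factorization as long as possible leaves a simple indecomposable
  \<open>m\<close>-factorization of some \<open>l K\<^sub>v\<close> with \<open>0 < l \<le> m\<close> (\<open>exists_indecomposable\<close>). The value of
  \<open>l\<close> is not known, but its form is forced: counting edges at one vertex shows that
  \<open>m = q * A\<close> divides \<open>l * Q * B\<close>. As \<open>A\<close> is coprime to \<open>q\<close>, it divides \<open>l * B\<close>, and hence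
  \<open>A / gcd A B\<close> divides \<open>l\<close>. The quotient \<open>t\<close> is at most \<open>q * d\<close> because \<open>l \<le> q * A\<close>, which is far
  below the required bound (\<open>size_bound\<close>).
\<close>

section \<open>Counting degrees\<close>

lemma mdegree_sum_mset: "mdegree (\<Sum>\<^sub># F) x = (\<Sum>G\<in>#F. mdegree G x)"
  by (induction F) (auto simp: mdegree_def)

lemma mdegree_repeat_mset: "mdegree (repeat_mset l G) x = l * mdegree G x"
  by (induction l) (auto simp: mdegree_def)

lemma mdegree_edge_set:
  assumes "finite V" "x \<in> V"
  shows "mdegree (mset_set {e. e \<subseteq> V \<and> card e = 2 \<and> P e}) x = card {y \<in> V - {x}. P {x, y}}"
proof -
  let ?S = "{e. e \<subseteq> V \<and> card e = 2 \<and> P e}"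
  have "finite ?S"
    using assms(1) by (auto intro: finite_subset[of _ "Pow V"])
  then have "mdegree (mset_set ?S) x = card {e \<in> ?S. x \<in> e}"
    by (simp add: mdegree_def filter_mset_mset_set)
  also have "{e \<in> ?S. x \<in> e} = (\<lambda>y. {x, y}) ` {y \<in> V - {x}. P {x, y}}"
  proof (intro equalityI subsetI)
    fix e assume "e \<in> {e \<in> ?S. x \<in> e}"
    then obtain a b where "e = {a, b}" "a \<noteq> b" "x \<in> e" "e \<subseteq> V" "P e"
      by (auto simp: card_2_iff)
    then show "e \<in> (\<lambda>y. {x, y}) ` {y \<in> V - {x}. P {x, y}}"
      by (cases "x = a") (auto simp: insert_commute)
  qed (use assms in \<open>auto simp: card_2_iff\<close>)
  also have "card \<dots> = card {y \<in> V - {x}. P {x, y}}"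
    by (rule card_image) (auto simp: inj_on_def doubleton_eq_iff)
  finally show ?thesis .
qed

lemma mdegree_complete:
  assumes "finite V" "x \<in> V"
  shows "mdegree (complete_mgraph l V) x = l * (card V - 1)"
proof -
  have "{y \<in> V - {x}. True} = V - {x}"
    by blast
  then show ?thesis
    using mdegree_edge_set[OF assms, of "\<lambda>_. True"] assms
    by (simp add: complete_mgraph_def mdegree_repeat_mset del: Diff_iff)
qed

text \<open>
  Both sides count the edges at one vertex: every factor contributes \<open>m\<close> of them, and
  \<open>l\<close> parallel edges lead to each other vertex.
\<close>

lemma size_factorization:
  assumes "factorization m l V F" "finite V" "x \<in> V"
  shows "size F * m = l * (card V - 1)"
proof -
  have "size F * m = (\<Sum>G\<in>#F. m)"
    by simp
  also have "\<dots> = (\<Sum>G\<in>#F. mdegree G x)"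
    using assms by (intro arg_cong[where f = sum_mset] image_mset_cong)
      (auto simp: factorization_def is_factor_def)
  also have "\<dots> = l * (card V - 1)"
    using assms mdegree_complete[of V x l] by (simp add: mdegree_sum_mset[symmetric] factorization_def)
  finally show ?thesis .
qed

section \<open>Splitting off an indecomposable factorization\<close>

text \<open>
  A part of a simple factorization is again simple, and both parts of a decomposition have smaller
  multiplicity. So splitting must stop, and it stops at an indecomposable factorization.
\<close>

lemma exists_indecomposable:
  assumes "factorization m l V F" "simple_factorization F" "l > 0"
  shows "\<exists>l' F'. 0 < l' \<and> l' \<le> l \<and> factorization m l' V F' \<and> simple_factorization F'
    \<and> \<not> decomposable m l' V F'"
  using assms
proof (induction l arbitrary: F rule: less_induct)
  case (less l)
  show ?case
  proof (cases "decomposable m l V F")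
    case True
    then obtain l1 l2 F1 F2 where *: "l1 > 0" "l2 > 0" "l1 + l2 = l"
      "factorization m l1 V F1" "F = F1 + F2"
      unfolding decomposable_def by blast
    have "count F1 G = 1" if "G \<in># F1" for G
    proof -
      have "count F G = 1"
        using less.prems(2) that * by (simp add: simple_factorization_def)
      then have "count F1 G \<le> 1"
        using * by simp
      moreover have "count F1 G > 0"
        using that by (simp only: count_greater_zero_iff)
      ultimately show ?thesis
        by linarith
    qed
    then have "simple_factorization F1"
      by (simp add: simple_factorization_def)
    with less.IH[of l1 F1] * show ?thesis
      by fastforce
  next
    case False
    with less.prems show ?thesis
      by blast
  qed
qed

section \<open>Factorizations from cyclic windows of colours\<close>

text \<open>
  Translation by \<open>j\<close> permutes the residues modulo \<open>N\<close>. As \<open>i\<close> and \<open>j\<close> enter symmetrically, the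
  same count gives the number of colours in a window and the number of windows containing a colour.
\<close>

lemma card_cyclic_window:
  fixes N w j :: nat
  assumes "w \<le> N"
  shows "card {i \<in> {..<N}. (i + j) mod N < w} = w"
proof -
  let ?f = "\<lambda>i. (i + j) mod N"
  have inj: "inj_on ?f {..<N}"
  proof (rule inj_onI)
    fix a b assume "a \<in> {..<N}" "b \<in> {..<N}" "(a + j) mod N = (b + j) mod N"
    then show "a = b"
      using cong_add_rcancel_nat[of a j b N] by (simp add: cong_def)
  qed
  then have "?f ` {..<N} = {..<N}"
    by (intro endo_inj_surj) auto
  moreover have "?f ` {i \<in> {..<N}. ?f i < w} = ?f ` {..<N} \<inter> {..<w}"
    by auto
  ultimately have "?f ` {i \<in> {..<N}. ?f i < w} = {..<w}"
    using assms by auto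
  moreover have "inj_on ?f {i \<in> {..<N}. ?f i < w}"
    using inj by (rule inj_on_subset) auto
  ultimately show ?thesis
    by (simp flip: card_image)
qed

text \<open>
  A window that is neither empty nor the whole cycle is determined by its starting point: the only
  residue that belongs to it although its predecessor does not.
\<close>

lemma cyclic_window_not_same:
  fixes N w j j' :: nat
  assumes "w < N" "0 < w" "j < j'" "j' < N"
  shows "\<exists>i<N. ((i + j) mod N < w) \<noteq> ((i + j') mod N < w)"
proof (rule ccontr)
  assume "\<not> ?thesis"
  then have same: "(i + j) mod N < w \<longleftrightarrow> (i + j') mod N < w" if "i < N" for i
    using that by blast
  \<comment> \<open>\<open>i0\<close> is the starting point of the window of \<open>j\<close> and \<open>i1\<close> its cyclic predecessor.
    In the window of \<open>j'\<close>, \<open>i0\<close> has the positive offset \<open>j' - j\<close>, so \<open>i1\<close> would belong to it, too.\<close>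
  define i0 i1 where "i0 = (N - j) mod N" and "i1 = N - 1 - j"
  have N: "i0 < N" "i1 < N"
    using assms by (auto simp: i0_def i1_def)
  have "(i0 + j) mod N = 0"
    using assms by (simp add: i0_def mod_simps)
  moreover have "(i0 + j') mod N = (N - j + j') mod N"
    by (simp add: i0_def mod_simps)
  moreover have "(N - j + j') mod N = j' - j"
  proof -
    have "N - j + j' = N + (j' - j)"
      using assms by simp
    also have "(N + (j' - j)) mod N = j' - j"
      using assms by (simp only: mod_add_self1 mod_less less_imp_diff_less)
    finally show ?thesis .
  qed
  ultimately have "j' - j < w"
    using same[OF N(1)] assms(2) by (simp only:)
  moreover have "(i1 + j') mod N = j' - j - 1"
  proof -
    have "i1 + j' = N + (j' - j - 1)"
      using assms by (simp add: i1_def)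
    also have "(N + (j' - j - 1)) mod N = j' - j - 1"
      using assms by (simp only: mod_add_self1 mod_less less_imp_diff_less)
    finally show ?thesis .
  qed
  ultimately have "(i1 + j') mod N < w"
    by simp
  moreover have "(i1 + j) mod N = N - 1"
    using assms by (simp add: i1_def)
  ultimately show False
    using same[OF N(2)] assms by simp
qed

text \<open>
  Each of the \<open>N\<close> colour classes is an \<open>r\<close>-factor of the complete graph on \<open>V\<close>. Regularity is
  expressed by counting neighbours rather than edges at a vertex.
\<close>

definition regular_colouring :: "nat \<Rightarrow> nat \<Rightarrow> 'a set \<Rightarrow> ('a set \<Rightarrow> nat) \<Rightarrow> bool" where
  "regular_colouring r N V c \<longleftrightarrow>
     (\<forall>e. e \<subseteq> V \<and> card e = 2 \<longrightarrow> c e < N) \<and>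
     (\<forall>x\<in>V. \<forall>i<N. card {y \<in> V - {x}. c {x, y} = i} = r)"

text \<open>
  The factors are the unions of \<open>w\<close> cyclically consecutive colour classes. An edge lies in as many
  of them as there are windows containing its colour, namely \<open>w\<close>.
\<close>

lemma factorization_of_regular_colouring:
  assumes c: "regular_colouring r N V c" and V: "finite V" "V \<noteq> {}"
    and w: "0 < w" "w < N" and r: "0 < r"
  shows "\<exists>F. factorization (r * w) w V F \<and> simple_factorization F"
proof -
  define S where "S j = {e. e \<subseteq> V \<and> card e = 2 \<and> (c e + j) mod N < w}" for j
  define G where "G j = mset_set (S j)" for j
  define F where "F = image_mset G (mset_set {..<N})"
  have finS: "finite (S j)" for j
    using V by (auto simp: S_def intro: finite_subset[of _ "Pow V"])
  have deg: "mdegree (G j) x = r * w" if x: "x \<in> V" for j x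
  proof -
    let ?I = "{i \<in> {..<N}. (i + j) mod N < w}"
    have col: "c {x, y} < N" if "y \<in> V - {x}" for y
      using c x that by (auto simp: regular_colouring_def)
    have "mdegree (G j) x = card {y \<in> V - {x}. (c {x, y} + j) mod N < w}"
      unfolding G_def S_def by (rule mdegree_edge_set[OF V(1) x])
    also have "{y \<in> V - {x}. (c {x, y} + j) mod N < w} = (\<Union>i\<in>?I. {y \<in> V - {x}. c {x, y} = i})"
      using col by auto
    also have "card \<dots> = (\<Sum>i\<in>?I. card {y \<in> V - {x}. c {x, y} = i})"
      using V by (intro card_UN_disjoint) auto
    also have "\<dots> = (\<Sum>i\<in>?I. r)"
      using c x by (intro sum.cong) (auto simp: regular_colouring_def)
    also have "\<dots> = r * w"
      using card_cyclic_window[of w N j] w by simp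
    finally show ?thesis .
  qed
  have sum: "\<Sum>\<^sub># F = complete_mgraph w V"
  proof (rule multiset_eqI)
    fix e
    have "count (\<Sum>\<^sub># F) e = (\<Sum>j<N. count (G j) e)"
      by (simp add: F_def count_sum sum_unfold_sum_mset[symmetric])
    also have "\<dots> = (\<Sum>j<N. if e \<in> S j then 1 else 0)"
      using finS by (simp add: G_def count_mset_set')
    also have "\<dots> = card {j \<in> {..<N}. e \<in> S j}"
      by (simp add: sum.If_cases Int_def)
    also have "\<dots> = (if e \<subseteq> V \<and> card e = 2 then w else 0)"
      using card_cyclic_window[of w N "c e"] w by (auto simp: S_def add.commute)
    also have "\<dots> = count (complete_mgraph w V) e"
    proof -
      have "finite {e. e \<subseteq> V \<and> card e = 2}"
        using V by (auto intro: finite_subset[of _ "Pow V"])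
      then show ?thesis
        by (simp add: complete_mgraph_def count_mset_set')
    qed
    finally show "count (\<Sum>\<^sub># F) e = count (complete_mgraph w V) e" .
  qed
  have "is_factor (r * w) w V (G j)" if "j < N" for j
  proof -
    have "G j \<subseteq># \<Sum>\<^sub># F"
      using that by (subst sum_mset.remove[of "G j"]) (auto simp: F_def)
    then show ?thesis
      using deg sum by (simp add: is_factor_def)
  qed
  then have fac: "factorization (r * w) w V F"
    using sum by (auto simp: factorization_def F_def)
  have neq: "G j \<noteq> G j'" if jj': "j < j'" "j' < N" for j j'
  proof -
    obtain i where i: "i < N" "((i + j) mod N < w) \<noteq> ((i + j') mod N < w)"
      using cyclic_window_not_same[OF w(2,1) jj'] by blast
    obtain x where x: "x \<in> V"
      using V by blast
    then have "card {y \<in> V - {x}. c {x, y} = i} = r"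
      using c i by (auto simp: regular_colouring_def)
    \<comment> \<open>Windows differing in the colour \<open>i\<close> give different graphs because \<open>i\<close> is used.\<close>
    then have "{y \<in> V - {x}. c {x, y} = i} \<noteq> {}"
      using r by (metis card.empty less_irrefl)
    then obtain y where "y \<in> V" "y \<noteq> x" "c {x, y} = i"
      by blast
    then have "({x, y} \<in> S j) \<noteq> ({x, y} \<in> S j')"
      using i x by (auto simp: S_def)
    then show ?thesis
      using finS by (metis G_def finite_set_mset_mset_set)
  qed
  have "inj_on G {..<N}"
    by (rule inj_onI) (metis neq lessThan_iff nat_neq_iff)
  then have "F = mset_set (G ` {..<N})"
    by (simp add: F_def image_mset_mset_set)
  then have "simple_factorization F"
    by (simp add: simple_factorization_def)
  with fac show ?thesis
    by blast
qed

section \<open>Regular colourings of complete graphs\<close>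

text \<open>
  On \<open>2 * N + 1\<close> points in a circle, two points are joined in colour \<open>i\<close> if their circular distance
  is \<open>i + 1\<close>. Since the number of points is odd, no point has an antipode, so each distance from
  \<open>1\<close> to \<open>N\<close> occurs twice at every point.
\<close>

lemma circulant_colouring:
  "\<exists>c. regular_colouring 2 N {..<2 * N + 1} c"
proof -
  define c :: "nat set \<Rightarrow> nat"
    where "c e = min (Max e - Min e) (2 * N + 1 - (Max e - Min e)) - 1" for e
  have c: "c {x, y} = min (max x y - min x y) (2 * N + 1 - (max x y - min x y)) - 1" for x y
    by (simp add: c_def)
  have "c e < N" if e: "e \<subseteq> {..<2 * N + 1}" "card e = 2" for e
  proof -
    obtain a b where "e = {a, b}" "a \<noteq> b"
      using e by (auto simp: card_2_iff)
    then have "0 < N"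
      using e by (cases N) auto
    then have "min j (2 * N + 1 - j) - 1 < N" for j
      by (cases "j \<le> N") auto
    then show ?thesis
      by (simp only: c_def)
  qed
  moreover have "card {y \<in> {..<2 * N + 1} - {x}. c {x, y} = i} = 2" if "x < 2 * N + 1" "i < N" for x i
  proof -
    \<comment> \<open>the points \<open>i + 1\<close> steps after and before \<open>x\<close>\<close>
    define s where "s = (if x + i + 1 < 2 * N + 1 then x + i + 1 else x + i - 2 * N)"
    define p where "p = (if i + 1 \<le> x then x - (i + 1) else x + 2 * N - i)"
    have s: "y = s \<longleftrightarrow> y = x + i + 1 \<or> y + 2 * N = x + i" if "y < 2 * N + 1" for y
      using that by (auto simp: s_def)
    have p: "y = p \<longleftrightarrow> y + i + 1 = x \<or> y + i = x + 2 * N" if "y < 2 * N + 1" for y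
      using that \<open>i < N\<close> by (auto simp: p_def)
    have circ: "min a (2 * N + 1 - a) - 1 = i \<longleftrightarrow> a = i + 1 \<or> a + i = 2 * N"
      if "0 < a" "a < 2 * N + 1" for a
      using that \<open>i < N\<close> by (cases "a \<le> N") auto
    have sp: "s < 2 * N + 1" "p < 2 * N + 1" "s \<noteq> x" "p \<noteq> x"
      using that by (auto simp: s_def p_def)
    have "c {x, y} = i \<longleftrightarrow> y = s \<or> y = p" if y: "y < 2 * N + 1" "y \<noteq> x" for y
    proof (cases "y < x")
      case True
      then obtain a where a: "x = y + a" "0 < a"
        using less_imp_add_positive by blast
      then have "c {x, y} = i \<longleftrightarrow> a = i + 1 \<or> a + i = 2 * N"
        using circ[of a] \<open>x < 2 * N + 1\<close> by (simp add: c)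
      then show ?thesis
        using s[OF y(1)] p[OF y(1)] a y \<open>i < N\<close> by auto
    next
      case False
      then obtain a where a: "y = x + a" "0 < a"
        using y less_imp_add_positive[of x y] by auto
      then have "c {x, y} = i \<longleftrightarrow> a = i + 1 \<or> a + i = 2 * N"
        using circ[of a] y by (simp add: c)
      then show ?thesis
        using s[OF y(1)] p[OF y(1)] a y \<open>i < N\<close> by auto
    qed
    then have "{y \<in> {..<2 * N + 1} - {x}. c {x, y} = i} = {s, p}"
      using sp by auto
    moreover have "s \<noteq> p"
      using that unfolding s_def p_def by auto
    ultimately show ?thesis
      by simp
  qed
  ultimately have "regular_colouring 2 N {..<2 * N + 1} c"
    by (auto simp: regular_colouring_def)
  then show ?thesis
    by blast
qed

text \<open>
  The classical 1-factorization: points below \<open>N\<close> are joined in the colour \<open>x + y\<close> modulo \<open>N\<close>.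
  At \<open>x\<close> this misses only the colour \<open>x + x\<close>, which is given to the edge from \<open>x\<close> to the
  additional point \<open>N\<close>. The edges at \<open>N\<close> have distinct colours because 2 is invertible modulo
  the odd number \<open>N\<close>.
\<close>

lemma round_robin_colouring:
  assumes "odd N"
  shows "\<exists>c. regular_colouring 1 N {..<N + 1} c"
proof -
  define c :: "nat set \<Rightarrow> nat"
    where "c e = ((if N \<in> e then 2 else 1) * \<Sum>(e - {N})) mod N" for e
  have wrap: "(a + b) mod N = (if a + b < N then a + b else a + b - N)" if "a < N" "b < N" for a b
    using that by (auto simp: mod_if)
  have c_inner: "c {x, y} = (x + y) mod N" if "x < N" "y < N" "x \<noteq> y" for x y
    using that by (auto simp: c_def)
  have c_hub: "c {x, N} = (x + x) mod N" "c {N, x} = (x + x) mod N" if "x < N" for x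
    using that by (auto simp: c_def insert_Diff_if mult_2)
  have "c e < N" for e
    using assms by (simp add: c_def odd_pos)
  moreover have "card {y \<in> {..<N + 1} - {x}. c {x, y} = i} = 1" if x: "x < N + 1" and i: "i < N" for x i
  proof (cases "x = N")
    case True
    \<comment> \<open>half of \<open>i\<close> modulo \<open>N\<close>\<close>
    define h where "h = (if even i then i div 2 else (i + N) div 2)"
    have "{y \<in> {..<N + 1} - {x}. c {x, y} = i} = {y \<in> {..<N}. (y + y) mod N = i}"
      using True by (auto simp: c_hub)
    also have "\<dots> = {h}"
    proof (rule set_eqI)
      fix y
      show "y \<in> {y \<in> {..<N}. (y + y) mod N = i} \<longleftrightarrow> y \<in> {h}"
      proof (cases "y < N")
        case True
        then have "(y + y) mod N = i \<longleftrightarrow> y + y = i \<or> y + y = i + N"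
          using i by (auto simp: wrap)
        also have "\<dots> \<longleftrightarrow> y = h"
        proof (cases "even i")
          case True
          then obtain a where "i = 2 * a"
            by (elim evenE)
          moreover have "y + y \<noteq> i + N"
            using True assms by (metis even_add)
          ultimately show ?thesis
            by (auto simp: h_def)
        next
          case False
          then have "even (i + N)"
            using assms by simp
          then obtain a where "i + N = 2 * a"
            by (elim evenE)
          moreover have "y + y \<noteq> i"
            using False by (metis even_add)
          ultimately show ?thesis
            using False by (auto simp: h_def)
        qed
        finally show ?thesis
          using True by simp
      next
        case False
        then show ?thesis
          using i assms by (auto simp: h_def)
      qed
    qed
    finally show ?thesis
      by simp
  next
    case False
    with x have x: "x < N"
      by simp
    \<comment> \<open>\<open>i - x\<close> modulo \<open>N\<close>\<close>
    define p where "p = (if x \<le> i then i - x else i + N - x)"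
    have "{y \<in> {..<N + 1} - {x}. c {x, y} = i} = {if p = x then N else p}"
    proof (rule set_eqI)
      fix y
      consider "y < N" "y \<noteq> x" | "y = x" | "y = N" | "y > N"
        by linarith
      then show "y \<in> {y \<in> {..<N + 1} - {x}. c {x, y} = i} \<longleftrightarrow> y \<in> {if p = x then N else p}"
      proof cases
        case 1
        then show ?thesis
          using x i by (auto simp: c_inner wrap p_def)
      next
        case 2
        then show ?thesis
          using x by auto
      next
        case 3
        then show ?thesis
          using x i by (auto simp: c_hub wrap p_def)
      next
        case 4
        then show ?thesis
          using x i by (auto simp: p_def)
      qed
    qed
    then show ?thesis
      by simp
  qed
  ultimately have "regular_colouring 1 N {..<N + 1} c"
    by (auto simp: regular_colouring_def)
  then show ?thesis
    by blast
qed

text \<open>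
  The parity hypothesis is the handshake condition for an \<open>m\<close>-regular graph on \<open>v\<close> points; it lets
  2-factors suffice when \<open>v\<close> is odd.
\<close>

lemma exists_simple_factorization:
  assumes "0 < m" "m < v - 1" "even (m * v)"
  shows "\<exists>l F. 0 < l \<and> l \<le> m \<and> factorization m l {..<v} F \<and> simple_factorization F"
proof (cases "even v")
  case True
  have v: "{..<v - 1 + 1} = {..<v}"
    using assms(2) by simp
  have odd: "odd (v - 1)"
    using True assms(2) by simp
  obtain c where "regular_colouring 1 (v - 1) {..<v} c"
    using round_robin_colouring[OF odd] unfolding v by blast
  from factorization_of_regular_colouring[OF this, of m] assms show ?thesis
    by (auto simp: lessThan_empty_iff)
next
  case False
  then obtain N where v: "v = 2 * N + 1"
    by (elim oddE)
  from False assms(3) obtain w where m: "m = 2 * w"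
    by auto
  obtain c where "regular_colouring 2 N {..<v} c"
    using circulant_colouring[of N] v by blast
  from factorization_of_regular_colouring[OF this, of w] assms v m
  obtain F where "factorization m w {..<v} F" "simple_factorization F"
    by (auto simp: lessThan_empty_iff)
  then show ?thesis
    using assms m by (intro exI[of _ w] exI[of _ F]) auto
qed

section \<open>The parameters\<close>

lemma geometric_sum_nat:
  fixes x :: nat
  assumes "x > 1"
  shows "(x ^ n - 1) div (x - 1) = (\<Sum>i<n. x ^ i)"
proof -
  have "(x - 1) * (\<Sum>i<n. x ^ i) = x ^ n - 1"
  proof (induction n)
    case (Suc n)
    have "x ^ n \<ge> 1"
      using assms by simp
    then show ?case
      using Suc assms by (simp add: algebra_simps diff_mult_distrib)
  qed simp
  then show ?thesis
    using assms by (metis nonzero_mult_div_cancel_left zero_less_diff less_numeral_extra(3))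
qed

lemma odd_sum_powers_iff:
  fixes x :: nat
  assumes "odd x"
  shows "odd (\<Sum>i<n. x ^ i) \<longleftrightarrow> odd n"
  using assms by (induction n) auto

text \<open>
  The right-hand side is generous. Already \<open>q ^ (((n + 1) choose 2) * k)\<close> exceeds
  \<open>q * q ^ (k - 1) * (n + 1)\<close>, since \<open>n + k \<le> (n + 1) * k \<le> ((n + 1) choose 2) * k\<close> for \<open>n \<ge> 2\<close> and
  \<open>n + 1 \<le> q ^ n\<close>; all remaining factors are at least 1.
\<close>

lemma size_bound:
  fixes q k n d :: nat
  assumes "q \<ge> 2" "k \<ge> 1" "n \<ge> 2"
  shows "real (q * d) \<le> real d * (real q ^ (((n + 1) choose 2) * k) * (real q ^ k - 1))
                / (real q ^ (k - 1) * real (n + 1))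
              * (\<Prod>i=1..n-1. (real q ^ (k * i) - 1))"
proof -
  let ?P = "\<Prod>i=1..n-1. (real q ^ (k * i) - 1)"
  have big: "real q ^ j - 1 \<ge> 1" if "j \<ge> 1" for j
  proof -
    have "(2::real) ^ 1 \<le> real q ^ 1"
      using assms by simp
    also have "real q ^ 1 \<le> real q ^ j"
      using assms that by (intro power_increasing) auto
    finally show ?thesis
      by simp
  qed
  have P: "?P \<ge> 1"
    using assms by (intro prod_ge_1 big) auto
  have "n + 1 \<le> (n + 1) choose 2"
  proof -
    have "(n + 1) * 2 \<le> (n + 1) * n"
      using assms by (intro mult_le_mono2)
    then have "n + 1 \<le> (n + 1) * n div 2"
      by (simp only: less_eq_div_iff_mult_less_eq zero_less_numeral)
    then show ?thesis
      by (simp only: choose_two diff_add_inverse2)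
  qed
  then have "(n + 1) * k \<le> ((n + 1) choose 2) * k"
    by (rule mult_le_mono1)
  moreover have "n * 1 \<le> n * k"
    using assms by (intro mult_le_mono2)
  ultimately have "n + k \<le> ((n + 1) choose 2) * k"
    by (simp only: add_mult_distrib mult_1_right mult_1)
  then have "real q ^ (n + k) \<le> real q ^ (((n + 1) choose 2) * k)"
    using assms by (intro power_increasing) auto
  moreover have "real (n + 1) \<le> real q ^ n"
  proof -
    have "n + 1 \<le> 2 ^ n"
      by (induction n) auto
    also have "(2::nat) ^ n \<le> q ^ n"
      using assms by (intro power_mono) auto
    finally show ?thesis
      by (metis of_nat_le_iff of_nat_power)
  qed
  moreover have "real q ^ k = real q * real q ^ (k - 1)"
    using assms by (simp add: power_eq_if)
  ultimately have "real q * (real q ^ (k - 1) * real (n + 1)) \<le> real q ^ (((n + 1) choose 2) * k)"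
    using mult_left_mono[of "real (n + 1)" "real q ^ n" "real q ^ k"]
    by (simp add: power_add mult_ac)
  also have "\<dots> \<le> real q ^ (((n + 1) choose 2) * k) * ((real q ^ k - 1) * ?P)"
  proof -
    have "1 * 1 \<le> (real q ^ k - 1) * ?P"
      using P big[OF assms(2)] by (intro mult_mono) auto
    from mult_left_mono[OF this, of "real q ^ (((n + 1) choose 2) * k)"] show ?thesis
      by simp
  qed
  finally have "real q \<le> real q ^ (((n + 1) choose 2) * k) * ((real q ^ k - 1) * ?P)
      / (real q ^ (k - 1) * real (n + 1))"
    using assms by (subst pos_le_divide_eq) auto
  from mult_left_mono[OF this, of "real d"] show ?thesis
    by (simp add: mult_ac)
qed

theorem theorem4p14:
  fixes q k n d v m :: nat
  assumes "primepow q"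
    and "k > 1" and "n > 0"
    and "gcd k (n + 1) = 1" and "gcd k n \<noteq> 1"
    and "d = gcd ((q ^ (k * n) - 1) div (q ^ k - 1)) ((q ^ n - 1) div (q - 1))"
    and "v = (q ^ (k * (n + 1)) - 1) div (q ^ k - 1)"
    and "m = q * ((q ^ n - 1) div (q - 1))"
  shows "\<exists>(t::nat) (l::nat) (F :: nat mgraph multiset).
     1 \<le> t \<and>
     real t \<le> real d * (real q ^ (((n + 1) choose 2) * k) * (real q ^ k - 1))
                / (real q ^ (k - 1) * real (n + 1))
              * (\<Prod>i=1..n-1. (real q ^ (k * i) - 1)) \<and>
     real l = real t * ((real q ^ n - 1) / (real d * (real q - 1))) \<and>
     factorization m l {..<v} F \<and>
     simple_factorization F \<and>
     \<not> decomposable m l {..<v} F"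
proof -
  have q: "q \<ge> 2"
    using primepow_gt_Suc_0[OF assms(1)] by simp
  \<comment> \<open>For \<open>n = 1\<close> the greatest common divisor of \<open>k\<close> and \<open>n\<close> would be 1.\<close>
  have n: "n \<ge> 2"
    using assms(3,5) by (cases "n = 1") auto
  have Q: "q ^ k > 1"
    using q assms(2) by (intro one_less_power) auto
  define A where "A = (\<Sum>i<n. q ^ i)"
  define B where "B = (\<Sum>i<n. (q ^ k) ^ i)"
  have A: "(q ^ n - 1) div (q - 1) = A"
    unfolding A_def using q by (intro geometric_sum_nat) auto
  have B: "(q ^ (k * n) - 1) div (q ^ k - 1) = B"
    unfolding B_def power_mult by (intro geometric_sum_nat Q)
  have v_sum: "v = (\<Sum>i<n + 1. (q ^ k) ^ i)"
    unfolding assms(7) power_mult by (intro geometric_sum_nat Q)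
  have v: "v = q ^ k * B + 1"
    unfolding v_sum B_def by (simp add: sum.lessThan_Suc_shift sum_distrib_left del: sum.lessThan_Suc)
  have m: "m = q * A"
    using assms(8) A by simp
  have d: "d = gcd B A"
    using assms(6) A B by simp
  have A_pos: "A > 0"
    using q assms(3) unfolding A_def by (intro sum_pos) auto
  then have d_pos: "d > 0"
    by (simp add: d)
  have "q ^ i \<le> (q ^ k) ^ i" for i
    using q assms(2) by (intro power_mono self_le_power) auto
  then have "A \<le> B"
    unfolding A_def B_def by (intro sum_mono)
  moreover have "q < q ^ k"
    using power_strict_increasing[of 1 k q] q assms(2) by simp
  ultimately have "q * A < q ^ k * B"
    using A_pos by (intro mult_less_le_imp_less) auto
  then have m_less: "m < v - 1"
    by (simp add: m v)
  have "even (m * v)"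
    using odd_sum_powers_iff[of q n] odd_sum_powers_iff[of "q ^ k" "n + 1"]
    unfolding m v_sum A_def by auto
  moreover have "0 < m"
    using m A_pos q by simp
  ultimately obtain l0 F0 where "0 < l0" "l0 \<le> m" "factorization m l0 {..<v} F0"
    "simple_factorization F0"
    using exists_simple_factorization[of m v] m_less by blast
  with exists_indecomposable obtain l F where F: "0 < l" "l \<le> l0" "factorization m l {..<v} F"
    "simple_factorization F" "\<not> decomposable m l {..<v} F"
    by metis
  \<comment> \<open>The degree count at the vertex 0 forces \<open>l\<close> to be a multiple of \<open>A / d\<close>.\<close>
  have "size F * (q * A) = l * (q ^ k * B)"
    using size_factorization[OF F(3), of 0] by (simp add: v m)
  also have "\<dots> = q ^ k * (l * B)"
    by simp
  finally have "A dvd q ^ k * (l * B)"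
    by (metis dvd_triv_right mult.assoc)
  moreover have "coprime A q"
  proof -
    obtain n' where "n = Suc n'"
      using assms(3) by (cases n) auto
    then have "A = q * (\<Sum>i<n'. q ^ i) + 1"
      unfolding A_def by (simp add: sum.lessThan_Suc_shift sum_distrib_left del: sum.lessThan_Suc)
    then show ?thesis
      using coprime_add_one_left[of "q * (\<Sum>i<n'. q ^ i)"] by (simp only: coprime_mult_right_iff)
  qed
  ultimately have "A dvd l * B"
    by (simp add: coprime_dvd_mult_right_iff)
  moreover obtain A' B' where AB: "A = A' * d" "B = B' * d" "coprime A' B'"
    using d d_pos by (metis gcd_coprime_exists gcd.commute less_irrefl)
  ultimately have "A' dvd l"
    using d_pos by (simp add: coprime_dvd_mult_left_iff flip: mult.assoc)
  then obtain t where t: "l = A' * t"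
    by (elim dvdE)
  have "A' * t \<le> A' * (q * d)"
    using order_trans[OF F(2) \<open>l0 \<le> m\<close>] unfolding t m AB(1) by (simp only: mult_ac)
  moreover have "0 < A'"
    using A_pos AB(1) by simp
  ultimately have "t \<le> q * d"
    by (simp only: mult_le_cancel1)
  then have "real t \<le> real (q * d)"
    by (simp only: of_nat_le_iff)
  also note size_bound[of q k n d]
  finally have bound: "real t \<le> real d * (real q ^ (((n + 1) choose 2) * k) * (real q ^ k - 1))
                / (real q ^ (k - 1) * real (n + 1))
              * (\<Prod>i=1..n-1. (real q ^ (k * i) - 1))"
    using q n assms(2) by simp
  have "(real q ^ n - 1) / (real q - 1) = real A"
    unfolding A_def using q by (simp add: geometric_sum)
  then have "(real q ^ n - 1) / (real d * (real q - 1)) = real A'"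
    using d_pos unfolding AB(1) by (subst mult.commute) (simp flip: divide_divide_eq_left)
  then have "real l = real t * ((real q ^ n - 1) / (real d * (real q - 1)))"
    by (simp add: t)
  moreover have "1 \<le> t"
    using F(1) t by (cases t) auto
  ultimately show ?thesis
    using bound F by blast
qed

end
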